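(* Let $1\le m\le M-1$ be integers and let $A,B\in\mathbb{R}^{M\times M}_{\rm sym}$ with $A\succeq0$ and $[A,B]=0$. Set $C:=B-\frac12A^2$ and denote by $c_1\le c_2\le\cdots\le c_M$ the eigenvalues of $C$ (counted with multiplicities). The minimizers of $J(P)=\mathrm{Tr}(BP)-\frac12\mathrm{Tr}(APAP)$ over $\mathcal M=\mathrm{Gr}(m,\mathbb{R}^M)$ are exactly the matrices $$P_\star=\mathbf 1_{(-\infty,c_m)}(C)+\Delta,$$ where $\Delta\in\mathbb{R}^{M\times M}$ satisfies $\Delta^2=\Delta=\Delta^T$, $\mathrm{Ran}(\Delta)\subset\mathrm{Ker}(C-c_m)$, $\mathrm{Tr}(P_\star)=m$, and $[A,\Delta]=0$. In particular, if $c_m<c_{m+1}$, then $P_\star:=\mathbf 1_{(-\infty,c_m]}(C)$ is the unique minimizer of $J$ over $\mathcal M$, and the matrices $A$, $B$, $C$ and $P_\star$ pairwise commute.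
   Context: $\mathbb{R}^{M\times M}_{\rm sym}$ is the space of real symmetric $M\times M$ matrices, $[X,Y]=XY-YX$, and $\mathrm{Gr}(m,\mathbb{R}^M):=\{P\in\mathbb{R}^{M\times M}_{\rm sym} : P^2=P,\ \mathrm{Tr}(P)=m\}$ is the set of rank-$m$ orthogonal projectors. For $H$ real symmetric and $I\subset\mathbb{R}$, $\mathbf 1_I(H)$ is the spectral projector of $H$ on $I$ (orthogonal projector onto the sum of the eigenspaces of $H$ with eigenvalues in $I$). *)

theory Defs
  imports "HOL-Analysis.Analysis" "HOL-Library.Multiset"
begin

definition symmetric :: "real^'n^'n \<Rightarrow> bool" where
  "symmetric X \<longleftrightarrow> transpose X = X"

definition psd :: "real^'n^'n \<Rightarrow> bool" where
  "psd X \<longleftrightarrow> symmetric X \<and> (\<forall>x. 0 \<le> x \<bullet> (X *v x))"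

definition commutator :: "real^'n^'n \<Rightarrow> real^'n^'n \<Rightarrow> real^'n^'n" where
  "commutator X Y = X ** Y - Y ** X"

definition Gr :: "nat \<Rightarrow> (real^'n^'n) set" where
  "Gr m = {P. symmetric P \<and> P ** P = P \<and> trace P = real m}"

definition Ker :: "real^'n^'n \<Rightarrow> (real^'n) set" where
  "Ker X = {x. X *v x = 0}"

definition Ran :: "real^'n^'n \<Rightarrow> (real^'n) set" where
  "Ran X = range ((*v) X)"

text \<open>\<^term>\<open>mat \<mu>\<close> is the scalar matrix with \<open>\<mu>\<close> on the diagonal.\<close>

definition eigenspace :: "real^'n^'n \<Rightarrow> real \<Rightarrow> (real^'n) set" where
  "eigenspace H \<mu> = Ker (H - mat \<mu>)"

definition orth_projector :: "(real^'n) set \<Rightarrow> real^'n^'n" where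
  "orth_projector S = (THE P. symmetric P \<and> P ** P = P \<and> Ran P = S)"

definition spectral_projector :: "real set \<Rightarrow> real^'n^'n \<Rightarrow> real^'n^'n" where
  "spectral_projector I H = orth_projector (span (\<Union>\<mu>\<in>I. eigenspace H \<mu>))"

text \<open>
  The multiplicity of an eigenvalue is the dimension of its eigenspace; the definition is
  only used for symmetric \<open>H\<close>, where this is also the algebraic multiplicity.
\<close>

definition eigenvalues :: "real^'n^'n \<Rightarrow> real multiset" where
  "eigenvalues H =
     (\<Sum>\<mu> | eigenspace H \<mu> \<noteq> {0}. replicate_mset (dim (eigenspace H \<mu>)) \<mu>)"

text \<open>The \<open>k\<close>-th smallest eigenvalue, counted from \<open>k = 1\<close>.\<close>

definition kth_eigenvalue :: "real^'n^'n \<Rightarrow> nat \<Rightarrow> real" where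
  "kth_eigenvalue H k = sorted_list_of_multiset (eigenvalues H) ! (k - 1)"

definition J :: "real^'n^'n \<Rightarrow> real^'n^'n \<Rightarrow> real^'n^'n \<Rightarrow> real" where
  "J A B P = trace (B ** P) - (1/2) * trace (A ** P ** A ** P)"

definition minimizers :: "('a \<Rightarrow> real) \<Rightarrow> 'a set \<Rightarrow> 'a set" where
  "minimizers f S = {x. is_arg_min f (\<lambda>x. x \<in> S) x}"

text \<open>The definite description in \<^const>\<open>orth_projector\<close> is well defined on subspaces.\<close>

lemma symmetric_inner: "symmetric X \<Longrightarrow> (X *v x) \<bullet> y = x \<bullet> (X *v y)"
  by (metis dot_lmul_matrix symmetric_def vector_transpose_matrix)

lemma orth_projector_ex1:
  fixes S :: "(real^'n) set"
  assumes S: "subspace S"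
  shows "\<exists>!P. symmetric P \<and> P ** P = P \<and> Ran P = S"
proof (rule ex_ex1I)
  have "\<exists>y. y \<in> S \<and> (\<forall>s\<in>S. (x - y) \<bullet> s = 0)" for x
  proof -
    obtain y z where "y \<in> span S" "\<And>w. w \<in> span S \<Longrightarrow> orthogonal z w" "x = y + z"
      by (rule orthogonal_subspace_decomp_exists[of S x]) blast
    thus ?thesis
      using S by (intro exI[of _ y]) (auto simp: orthogonal_def span_eq_iff[THEN iffD2])
  qed
  then obtain p where pS: "\<And>x. p x \<in> S" and po: "\<And>x s. s \<in> S \<Longrightarrow> (x - p x) \<bullet> s = 0"
    by metis
  have uniq: "y = p x" if "y \<in> S" "\<And>s. s \<in> S \<Longrightarrow> (x - y) \<bullet> s = 0" for x y
  proof -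
    have "y - p x \<in> S" using that(1) pS S by (simp add: subspace_diff)
    hence "(x - p x) \<bullet> (y - p x) - (x - y) \<bullet> (y - p x) = 0" using po that(2) by simp
    hence "(y - p x) \<bullet> (y - p x) = 0" by (simp add: inner_diff_left)
    thus ?thesis by simp
  qed
  have lin: "linear p"
  proof (rule linearI)
    fix x y :: "real^'n" and r :: real
    have "p x + p y = p (x + y)"
      by (rule uniq) (use po[of _ x] po[of _ y] in \<open>auto simp: pS S subspace_add inner_diff_left inner_add_left\<close>)
    thus "p (x + y) = p x + p y" by simp
    have "r *\<^sub>R p x = p (r *\<^sub>R x)"
      by (rule uniq) (use po[of _ x] in \<open>auto simp: pS S subspace_scale inner_diff_left\<close>)
    thus "p (r *\<^sub>R x) = r *\<^sub>R p x" by simp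
  qed
  have M: "matrix p *v x = p x" for x
    using lin by (simp add: matrix_works)
  have fixS: "p y = y" if "y \<in> S" for y
    using uniq[of y y] that by simp
  have pi: "p x \<bullet> y = x \<bullet> p y" for x y
    using po[OF pS[of y], of x] po[OF pS[of x], of y]
    by (simp add: inner_diff_left inner_diff_right inner_commute)
  have "symmetric (matrix p)"
    unfolding symmetric_def matrix_eq
    by (metis M pi dot_lmul_matrix vector_transpose_matrix inner_commute vector_eq_ldot transpose_matrix_vector)
  moreover have "matrix p ** matrix p = matrix p"
    unfolding matrix_eq by (simp add: matrix_vector_mul_assoc[symmetric] M fixS pS)
  moreover have "Ran (matrix p) = S"
    unfolding Ran_def using pS fixS by (auto simp: M) (metis rangeI)
  ultimately show "\<exists>P. symmetric P \<and> P ** P = P \<and> Ran P = S" by blast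
next
  fix P Q :: "real^'n^'n"
  assume P: "symmetric P \<and> P ** P = P \<and> Ran P = S"
    and Q: "symmetric Q \<and> Q ** Q = Q \<and> Ran Q = S"
  have PQ: "P *v (Q *v x) = Q *v x" and QP: "Q *v (P *v x) = P *v x" for x
    using P Q unfolding Ran_def by (metis (no_types, lifting) matrix_vector_mul_assoc rangeE rangeI)+
  show "P = Q"
    unfolding matrix_eq
  proof
    fix x
    have "(P *v x) \<bullet> y = (Q *v x) \<bullet> y" for y
      by (metis P Q PQ QP symmetric_inner)
    thus "P *v x = Q *v x" using vector_eq_rdot by blast
  qed
qed

end

theory Submission
  imports Defs
begin

text \<open>
  For an orthogonal projector \<open>P\<close> one has
  \<open>J(P) = Tr(CP) + 1/4 \<parallel>[A,P]\<parallel>\<^sup>2\<close> in the Frobenius norm, so \<open>J\<close> is bounded below by the linear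
  functional \<open>Tr(CP)\<close>, with equality iff \<open>P\<close> commutes with \<open>A\<close>. In a common orthonormal
  eigenbasis \<open>e\<close> of \<open>A\<close> and \<open>C\<close> (\<open>C e = \<gamma>(e) e\<close>) this functional is the sum of
  \<open>\<gamma>(e) \<langle>e, P e\<rangle>\<close>, where the weights \<open>\<langle>e, P e\<rangle>\<close> lie in \<open>[0,1]\<close> and add up to \<open>m\<close>. It is minimal
  iff the weight is \<open>1\<close>, i.e. \<open>P e = e\<close>, below the level \<open>c\<^sub>m\<close> and \<open>0\<close>, i.e. \<open>P e = 0\<close>, above it.
  Both conditions are met by a projector onto \<open>m\<close> suitably chosen basis vectors.
\<close>

section \<open>Matrix arithmetic: sums, differences and scalar matrices\<close>

lemma transpose_add: "transpose (X + Y) = transpose X + transpose (Y :: 'a::plus^'n^'m)"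
  by (simp add: transpose_def vec_eq_iff)

lemma transpose_diff: "transpose (X - Y) = transpose X - transpose (Y :: 'a::minus^'n^'m)"
  by (simp add: transpose_def vec_eq_iff)

lemma matrix_diff_ldistrib: "X ** (Y - Z) = X ** Y - X ** (Z :: 'a::ring_1^'n^'m)"
  by (simp add: matrix_matrix_mult_def vec_eq_iff right_diff_distrib sum_subtractf)

lemma matrix_diff_rdistrib: "(X - Y) ** Z = X ** Z - Y ** (Z :: 'a::ring_1^'n^'m)"
  by (simp add: matrix_matrix_mult_def vec_eq_iff left_diff_distrib sum_subtractf)

lemma matrix_add_rdistrib: "(X + Y) ** Z = X ** Z + Y ** (Z :: 'a::semiring_1^'n^'m)"
  by (simp add: matrix_matrix_mult_def vec_eq_iff distrib_right sum.distrib)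

lemma mat_vector_mult: "mat r *v x = r *\<^sub>R (x :: real^'n)"
  by (simp add: mat_def matrix_vector_mult_def vec_eq_iff if_distrib if_distribR cong: if_cong)

section \<open>Common orthonormal eigenbases of commuting symmetric matrices\<close>

definition orthonormal_basis :: "(real^'n) set \<Rightarrow> bool" where
  "orthonormal_basis E \<longleftrightarrow> pairwise orthogonal E \<and> (\<forall>e\<in>E. norm e = 1) \<and> span E = UNIV"

text \<open>Working on an invariant subspace makes this applicable both inside an eigenspace of a
  commuting matrix and on the successive orthogonal complements of the induction below.\<close>

lemma symmetric_invariant_eigenvector:
  fixes A :: "real^'n^'n"
  assumes A: "symmetric A" and S: "subspace S" "S \<noteq> {0}"
    and inv: "\<And>x. x \<in> S \<Longrightarrow> A *v x \<in> S"
  obtains x l where "x \<in> S" "norm x = 1" "A *v x = l *\<^sub>R x"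
proof -
  let ?K = "S \<inter> sphere 0 1"
  have 0: "0 \<in> S" using S by (simp add: subspace_0)
  then obtain z where z: "z \<in> S" "z \<noteq> 0" using S(2) by auto
  have "(1 / norm z) *\<^sub>R z \<in> ?K" using z S by (simp add: subspace_scale)
  hence ne: "?K \<noteq> {}" by blast
  have "compact ?K" using S by (simp add: closed_Int_compact closed_subspace)
  moreover have "continuous_on ?K (\<lambda>x. x \<bullet> (A *v x))"
    by (intro continuous_on_inner continuous_on_id matrix_vector_mult_linear_continuous_on)
  ultimately obtain x where x: "x \<in> ?K" and max: "\<And>y. y \<in> ?K \<Longrightarrow> y \<bullet> (A *v y) \<le> x \<bullet> (A *v x)"
    using continuous_attains_sup[OF _ ne, of "\<lambda>x. x \<bullet> (A *v x)"] by blast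
  define l where "l = x \<bullet> (A *v x)"
  \<comment> \<open>Both sides are homogeneous of degree two in \<open>y\<close>, so the bound on
    the unit sphere extends to \<open>S\<close> by scaling.\<close>
  have q: "y \<bullet> (A *v y) \<le> l * (y \<bullet> y)" if "y \<in> S" for y
  proof (cases "y = 0")
    case False
    have "(1 / norm y) *\<^sub>R y \<in> ?K" using False that S by (simp add: subspace_scale)
    from max[OF this] have "(y \<bullet> (A *v y)) / (norm y * norm y) \<le> l"
      by (simp add: matrix_vector_mult_scaleR l_def)
    thus ?thesis using False by (simp add: divide_simps power2_norm_eq_inner[symmetric] power2_eq_square)
  qed simp
  have xx: "x \<bullet> x = 1" "x \<in> S" using x by (auto simp: norm_eq_1)
  \<comment> \<open>The maximizer \<open>x\<close> of the Rayleigh quotient is an eigenvector: its residual \<open>w\<close> vanishes because \<open>x + t w\<close> cannot improve the quotient to first order in \<open>t\<close>.\<close>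
  define w where "w = A *v x - l *\<^sub>R x"
  have w: "w \<in> S" using xx inv S by (simp add: w_def subspace_diff subspace_scale)
  have wxl: "w \<bullet> w = (A *v x) \<bullet> w - l * (x \<bullet> w)" by (simp add: w_def inner_diff_left)
  have sym: "x \<bullet> (A *v w) = (A *v x) \<bullet> w" using symmetric_inner[OF A] by simp
  have lin: "2 * t * (w \<bullet> w) \<le> t\<^sup>2 * (l * (w \<bullet> w) - w \<bullet> (A *v w))" for t
  proof -
    have "x + t *\<^sub>R w \<in> S" using xx w S by (simp add: subspace_add subspace_scale)
    from q[OF this] have le: "(x + t *\<^sub>R w) \<bullet> (A *v (x + t *\<^sub>R w)) \<le> l * ((x + t *\<^sub>R w) \<bullet> (x + t *\<^sub>R w))" .
    have lhs: "(x + t *\<^sub>R w) \<bullet> (A *v (x + t *\<^sub>R w))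
        = l + 2 * t * ((A *v x) \<bullet> w) + t\<^sup>2 * (w \<bullet> (A *v w))"
      using sym by (simp add: matrix_vector_right_distrib matrix_vector_mult_scaleR inner_add_left
          inner_add_right inner_commute power2_eq_square algebra_simps l_def)
    have rhs: "(x + t *\<^sub>R w) \<bullet> (x + t *\<^sub>R w) = 1 + 2 * t * (x \<bullet> w) + t\<^sup>2 * (w \<bullet> w)"
      using xx by (simp add: inner_add_left inner_add_right inner_commute power2_eq_square algebra_simps)
    have "(A *v x) \<bullet> w = w \<bullet> w + l * (x \<bullet> w)" using wxl by simp
    thus ?thesis using le unfolding lhs rhs by (simp add: algebra_simps)
  qed
  have "w \<bullet> w = 0"
  proof (rule ccontr)
    assume "w \<bullet> w \<noteq> 0"
    hence pos: "w \<bullet> w > 0" by (metis inner_eq_zero_iff inner_gt_zero_iff)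
    \<comment> \<open>The summand 1 makes \<open>k\<close> positive. With
      \<open>t = (w \<bullet> w) / k\<close> the bound \<open>t\<^sup>2 * k\<close> is
      \<open>t * (w \<bullet> w)\<close>, only half of the left side of \<open>lin\<close>, which is
      a contradiction.\<close>
    define k where "k = \<bar>l * (w \<bullet> w) - w \<bullet> (A *v w)\<bar> + 1"
    have k: "k > 0" "l * (w \<bullet> w) - w \<bullet> (A *v w) \<le> k" by (auto simp: k_def)
    define t where "t = (w \<bullet> w) / k"
    have t: "t > 0" using pos k by (simp add: t_def)
    have "2 * t * (w \<bullet> w) \<le> t\<^sup>2 * k" using lin[of t] k(2)
      by (meson mult_left_mono order_trans zero_le_power2)
    also have "\<dots> = t * (w \<bullet> w)" using k by (simp add: t_def power2_eq_square)
    finally show False using t pos by simp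
  qed
  hence "A *v x = l *\<^sub>R x" by (simp add: w_def)
  thus thesis using that x by auto
qed

text \<open>Induction on the dimension: a common unit eigenvector is split off, and its orthogonal
  complement in \<open>S\<close> stays invariant because both matrices are symmetric.\<close>

lemma commuting_eigenbasis_subspace:
  fixes A C :: "real^'n^'n"
  assumes A: "symmetric A" and C: "symmetric C" and AC: "A ** C = C ** A"
    and S: "subspace S" "\<And>x. x \<in> S \<Longrightarrow> A *v x \<in> S" "\<And>x. x \<in> S \<Longrightarrow> C *v x \<in> S"
  shows "\<exists>E. pairwise orthogonal E \<and> span E = S \<and>
    (\<forall>e\<in>E. norm e = 1 \<and> (\<exists>a. A *v e = a *\<^sub>R e) \<and> (\<exists>c. C *v e = c *\<^sub>R e))"
  using S
proof (induction "dim S" arbitrary: S rule: less_induct)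
  case less
  show ?case
  proof (cases "S = {0}")
    case True
    thus ?thesis by (intro exI[of _ "{}"]) auto
  next
    case False
    obtain u a where u: "u \<in> S" "norm u = 1" "A *v u = a *\<^sub>R u"
      using symmetric_invariant_eigenvector[OF A less.prems(1) False less.prems(2)] by blast
    \<comment> \<open>Since \<open>C\<close> commutes with \<open>A\<close>, it preserves this part
      of an eigenspace of \<open>A\<close>, so an eigenvector of \<open>C\<close> found in it is one
      of both matrices.\<close>
    define T where "T = {x\<in>S. A *v x = a *\<^sub>R x}"
    have "subspace T" using less.prems(1)
      by (auto simp: T_def subspace_def scaleR_right_distrib matrix_vector_right_distrib
          matrix_vector_mult_scaleR)
    moreover have "u \<in> T" "u \<noteq> 0" using u by (auto simp: T_def)
    hence "T \<noteq> {0}" by blast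
    moreover have "C *v x \<in> T" if "x \<in> T" for x
    proof -
      have "A *v (C *v x) = C *v (A *v x)" by (simp add: matrix_vector_mul_assoc AC)
      thus ?thesis using that less.prems(3) by (simp add: T_def matrix_vector_mult_scaleR)
    qed
    ultimately obtain x c where x: "x \<in> T" "norm x = 1" "C *v x = c *\<^sub>R x"
      using symmetric_invariant_eigenvector[OF C] by blast
    have xS: "x \<in> S" and Ax: "A *v x = a *\<^sub>R x" using x by (auto simp: T_def)
    define S' where "S' = {y\<in>S. orthogonal x y}"
    have sub: "subspace S'" using less.prems(1)
      by (auto simp: S'_def subspace_def orthogonal_clauses)
    have "x \<notin> S'" using x(2) by (auto simp: S'_def orthogonal_self)
    hence "S' \<subset> S" using xS by (auto simp: S'_def)
    hence "dim S' < dim S"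
      by (metis dim_psubset less.prems(1) span_eq_iff sub)
    moreover have "A *v y \<in> S'" "C *v y \<in> S'" if "y \<in> S'" for y
      using that less.prems(2,3) symmetric_inner[OF A, of x y] symmetric_inner[OF C, of x y] Ax x(3)
      by (auto simp: S'_def orthogonal_def)
    ultimately obtain E where E: "pairwise orthogonal E" "span E = S'"
      "\<And>e. e\<in>E \<Longrightarrow> norm e = 1 \<and> (\<exists>a. A *v e = a *\<^sub>R e) \<and> (\<exists>c. C *v e = c *\<^sub>R e)"
      using less.hyps[OF _ sub] by metis
    have xE: "orthogonal x e" if "e \<in> E" for e
      using span_base[OF that] E(2) by (auto simp: S'_def)
    have "span (insert x E) = S"
    proof
      show "span (insert x E) \<subseteq> S"
        by (rule span_minimal) (use xS E(2) less.prems(1) in \<open>auto simp: S'_def intro: span_base\<close>)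
      show "S \<subseteq> span (insert x E)"
      proof
        fix y assume y: "y \<in> S"
        have "y - (x \<bullet> y) *\<^sub>R x \<in> S'" using y xS less.prems(1) x(2)
          by (auto simp: S'_def subspace_diff subspace_scale orthogonal_def inner_diff_right norm_eq_1)
        thus "y \<in> span (insert x E)" using span_breakdown_eq E(2) by blast
      qed
    qed
    moreover have "pairwise orthogonal (insert x E)"
      using E(1) xE by (auto simp: pairwise_insert orthogonal_commute)
    ultimately show ?thesis using E(3) x Ax
      by (intro exI[of _ "insert x E"]) auto
  qed
qed

lemma commuting_eigenbasis:
  fixes A C :: "real^'n^'n"
  assumes "symmetric A" and "symmetric C" and "A ** C = C ** A"
  obtains E \<alpha> \<gamma> where "orthonormal_basis E"
    "\<And>e. e \<in> E \<Longrightarrow> A *v e = \<alpha> e *\<^sub>R e" "\<And>e. e \<in> E \<Longrightarrow> C *v e = \<gamma> e *\<^sub>R e"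
proof -
  obtain E where E: "pairwise orthogonal E" "span E = UNIV"
      "\<And>e. e\<in>E \<Longrightarrow> norm e = 1 \<and> (\<exists>a. A *v e = a *\<^sub>R e) \<and> (\<exists>c. C *v e = c *\<^sub>R e)"
    using commuting_eigenbasis_subspace[OF assms, of UNIV] by auto
  hence "\<exists>\<alpha>. \<forall>e\<in>E. A *v e = \<alpha> e *\<^sub>R e" "\<exists>\<gamma>. \<forall>e\<in>E. C *v e = \<gamma> e *\<^sub>R e"
    by (auto intro!: bchoice)
  thus thesis using that E unfolding orthonormal_basis_def by metis
qed

section \<open>Coordinates and traces in an orthonormal basis\<close>

lemma
  fixes E :: "(real^'n) set"
  assumes E: "orthonormal_basis E"
  shows orthonormal_basis_finite: "finite E"
    and orthonormal_basis_independent: "independent E"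
    and orthonormal_basis_card: "card E = CARD('n)"
    and orthonormal_basis_inner: "d \<in> E \<Longrightarrow> e \<in> E \<Longrightarrow> d \<bullet> e = (if d = e then 1 else 0)"
    and orthonormal_basis_sum: "(\<Sum>e\<in>E. (x \<bullet> e) *\<^sub>R e) = x"
proof -
  show fin: "finite E" using E pairwise_orthogonal_imp_finite by (auto simp: orthonormal_basis_def)
  show ind: "independent E"
    using E by (intro pairwise_orthogonal_independent) (auto simp: orthonormal_basis_def)
  have "span E = UNIV" using E by (simp add: orthonormal_basis_def)
  moreover have "dim (span E) = card E" using ind by (rule dim_span_eq_card_independent)
  ultimately have "dim (UNIV :: (real^'n) set) = card E" by metis
  thus "card E = CARD('n)" by simp
  show "d \<in> E \<Longrightarrow> e \<in> E \<Longrightarrow> d \<bullet> e = (if d = e then 1 else 0)"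
    using E by (auto simp: orthonormal_basis_def norm_eq_1 pairwise_def orthogonal_def)
  show "(\<Sum>e\<in>E. (x \<bullet> e) *\<^sub>R e) = x"
    using E fin by (intro orthonormal_basis_expand) (auto simp: orthonormal_basis_def)
qed

lemma orthonormal_basis_inner_sum:
  assumes "orthonormal_basis E"
  shows "x \<bullet> y = (\<Sum>e\<in>E. (x \<bullet> e) * (y \<bullet> e))"
proof -
  have "x \<bullet> y = x \<bullet> (\<Sum>e\<in>E. (y \<bullet> e) *\<^sub>R e)" by (simp add: orthonormal_basis_sum[OF assms])
  thus ?thesis by (simp add: inner_sum_right mult.commute)
qed

lemma orthonormal_basis_matrix_eqI:
  fixes X Y :: "real^'n^'n"
  assumes "orthonormal_basis E" and "\<And>e. e \<in> E \<Longrightarrow> X *v e = Y *v e"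
  shows "X = Y"
proof -
  have "X *v x = Y *v x" for x
    by (rule linear_eq_on[of "(*v) X" "(*v) Y" x E]) (use assms in \<open>auto simp: orthonormal_basis_def\<close>)
  thus ?thesis by (simp add: matrix_eq)
qed

text \<open>The Parseval identity for two axis vectors is the completeness relation
  \<open>ax\<close>; it collapses the expanded quadratic forms to the diagonal of
  \<open>X\<close>.\<close>

lemma trace_orthonormal_basis:
  fixes X :: "real^'n^'n"
  assumes E: "orthonormal_basis E"
  shows "trace X = (\<Sum>e\<in>E. e \<bullet> (X *v e))"
proof -
  have ax: "(\<Sum>e\<in>E. e $ i * e $ j) = (if i = j then 1 else 0)" for i j :: 'n
    using orthonormal_basis_inner_sum[OF E, of "axis i 1" "axis j 1"]
    by (simp add: inner_axis') (auto simp: axis_def split: if_splits)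
  have "(\<Sum>e\<in>E. e \<bullet> (X *v e)) = (\<Sum>e\<in>E. \<Sum>i\<in>UNIV. \<Sum>j\<in>UNIV. X $ i $ j * (e $ i * e $ j))"
    by (simp add: inner_vec_def matrix_vector_mult_def sum_distrib_left mult_ac)
  also have "\<dots> = (\<Sum>i\<in>UNIV. \<Sum>e\<in>E. \<Sum>j\<in>UNIV. X $ i $ j * (e $ i * e $ j))"
    by (rule sum.swap)
  also have "\<dots> = (\<Sum>i\<in>UNIV. \<Sum>j\<in>UNIV. \<Sum>e\<in>E. X $ i $ j * (e $ i * e $ j))"
    by (intro sum.cong refl sum.swap)
  also have "\<dots> = (\<Sum>i\<in>UNIV. \<Sum>j\<in>UNIV. X $ i $ j * (if i = j then 1 else 0))"
    by (simp add: sum_distrib_left[symmetric] ax)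
  also have "\<dots> = trace X" by (simp add: trace_def if_distrib cong: if_cong)
  finally show ?thesis by simp
qed

section \<open>The Frobenius norm and the commutator form of \<open>J\<close>\<close>

lemma trace_transpose_mult_self:
  fixes N :: "real^'n^'n"
  shows "trace (transpose N ** N) \<ge> 0" and "trace (transpose N ** N) = 0 \<longleftrightarrow> N = 0"
proof -
  have eq: "trace (transpose N ** N) = (\<Sum>i\<in>UNIV. \<Sum>j\<in>UNIV. (N $ j $ i)\<^sup>2)"
    by (simp add: trace_def matrix_matrix_mult_def transpose_def power2_eq_square)
  show "trace (transpose N ** N) \<ge> 0" by (simp add: eq sum_nonneg)
  show "trace (transpose N ** N) = 0 \<longleftrightarrow> N = 0"
    by (auto simp: eq sum_nonneg_eq_0_iff sum_nonneg vec_eq_iff)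
qed

text \<open>Cyclicity of the trace and \<open>P ** P = P\<close> reduce the squared norm of the
  commutator to \<open>2 * trace (A ** A ** P) - 2 * trace (A ** P ** A ** P)\<close>. A quarter of
  it is the quadratic part of \<open>J\<close> plus \<open>(1/2) * trace (A ** A ** P)\<close>,
  which the shift of \<open>B\<close> by \<open>(1/2) *\<^sub>R (A ** A)\<close> cancels.\<close>

lemma J_commutator:
  fixes A B P :: "real^'n^'n"
  assumes A: "symmetric A" and P: "symmetric P" "P ** P = P"
  shows "J A B P = trace ((B - (1/2) *\<^sub>R (A ** A)) ** P)
    + (1/4) * trace (transpose (commutator A P) ** commutator A P)"
proof -
  have tN: "transpose (commutator A P) = P ** A - A ** P"
    using A P by (simp add: commutator_def symmetric_def matrix_transpose_mul transpose_diff)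
  have ts: "trace (k *\<^sub>R X) = k * trace X" for k and X :: "real^'n^'n"
    by (simp add: trace_def sum_distrib_left)
  have a: "trace (P ** A ** P ** A) = trace (A ** P ** A ** P)"
    using trace_mul_sym[of P "A ** P ** A"] by (simp add: matrix_mul_assoc)
  have b: "trace (P ** A ** A ** P) = trace (A ** A ** P)"
    using trace_mul_sym[of P "A ** A ** P"] P(2) by (metis matrix_mul_assoc)
  have e: "trace (A ** P ** P ** A) = trace (A ** A ** P)"
    using trace_mul_sym[of "A ** P" A] P(2) by (metis matrix_mul_assoc)
  have "trace (transpose (commutator A P) ** commutator A P)
      = 2 * trace (A ** A ** P) - 2 * trace (A ** P ** A ** P)"
    unfolding tN by (simp add: commutator_def matrix_diff_ldistrib matrix_diff_rdistrib trace_sub matrix_mul_assoc a b e)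
  moreover have "trace ((B - (1/2) *\<^sub>R (A ** A)) ** P) = trace (B ** P) - (1/2) * trace (A ** A ** P)"
    by (simp add: matrix_diff_rdistrib trace_sub scalar_matrix_assoc[symmetric] ts)
  ultimately show ?thesis by (simp add: J_def field_simps)
qed

section \<open>Orthogonal projectors\<close>

text \<open>Turns the range condition on \<open>\<Delta>\<close> into a matrix equation, which can
  be transposed and tested on a basis.\<close>

lemma Ran_subset_Ker_iff: "Ran Y \<subseteq> Ker X \<longleftrightarrow> X ** Y = 0"
  by (auto simp: Ran_def Ker_def matrix_eq matrix_vector_mul_assoc[symmetric])

lemma symmetric_transpose_mult:
  assumes "symmetric X" and "symmetric Y"
  shows "transpose (X ** Y) = Y ** X"
  using assms by (simp add: matrix_transpose_mul symmetric_def)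

text \<open>The number \<open>e \<bullet> (P *v e)\<close> is the squared length of
  \<open>P *v e\<close>, and for a unit vector \<open>e\<close> its complement to 1 is the squared
  length of \<open>e - P *v e\<close>.\<close>

lemma
  fixes P :: "real^'n^'n"
  assumes P: "symmetric P" "P ** P = P" and e: "norm e = 1"
  shows projector_quadratic_nonneg: "0 \<le> e \<bullet> (P *v e)"
    and projector_quadratic_le_1: "e \<bullet> (P *v e) \<le> 1"
    and projector_quadratic_eq_0: "e \<bullet> (P *v e) = 0 \<longleftrightarrow> P *v e = 0"
    and projector_quadratic_eq_1: "e \<bullet> (P *v e) = 1 \<longleftrightarrow> P *v e = e"
proof -
  have PP: "P *v (P *v e) = P *v e" by (simp add: matrix_vector_mul_assoc P)
  have q: "e \<bullet> (P *v e) = (P *v e) \<bullet> (P *v e)" using symmetric_inner[OF P(1), of e "P *v e"] PP by simp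
  have ee: "e \<bullet> e = 1" using e by (simp add: norm_eq_1)
  have r: "(e - P *v e) \<bullet> (e - P *v e) = 1 - e \<bullet> (P *v e)"
    using q ee by (simp add: inner_diff_left inner_diff_right inner_commute)
  show "0 \<le> e \<bullet> (P *v e)" "e \<bullet> (P *v e) = 0 \<longleftrightarrow> P *v e = 0" by (simp_all add: q)
  show "e \<bullet> (P *v e) \<le> 1" using r inner_ge_zero[of "e - P *v e"] by linarith
  have "e \<bullet> (P *v e) = 1 \<longleftrightarrow> (e - P *v e) \<bullet> (e - P *v e) = 0" using r by auto
  thus "e \<bullet> (P *v e) = 1 \<longleftrightarrow> P *v e = e" by auto
qed

lemma orth_projector_props:
  fixes S :: "(real^'n) set"
  assumes "subspace S"
  shows "symmetric (orth_projector S)" "orth_projector S ** orth_projector S = orth_projector S"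
    "Ran (orth_projector S) = S"
  using theI'[OF orth_projector_ex1[OF assms]] by (auto simp: orth_projector_def)

section \<open>Matrices diagonal in a fixed orthonormal basis\<close>

text \<open>The basis is a parameter so that \<open>A\<close>, \<open>B\<close>, \<open>C\<close>
  and the projectors built from them can be instances for one and the same \<open>E\<close>.\<close>

locale eigenbasis =
  fixes C :: "real^'n^'n" and E :: "(real^'n) set" and \<gamma> :: "real^'n \<Rightarrow> real"
  assumes sym: "symmetric C"
    and basis: "orthonormal_basis E"
    and eigen: "\<And>e. e \<in> E \<Longrightarrow> C *v e = \<gamma> e *\<^sub>R e"

text \<open>The projector fixes its range, hence \<open>F\<close>. A vector \<open>e\<close> of
  \<open>E\<close> outside \<open>F\<close> is orthogonal to \<open>span F\<close>, and by symmetry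
  \<open>e \<bullet> (?P *v (?P *v e))\<close> is the squared length of \<open>?P *v e\<close>,
  which is therefore zero.\<close>

lemma orth_projector_span_eigenbasis:
  assumes E: "orthonormal_basis E" and F: "F \<subseteq> E"
  shows "eigenbasis (orth_projector (span F)) E (\<lambda>e. of_bool (e \<in> F))"
proof
  let ?P = "orth_projector (span F)"
  note P = orth_projector_props[OF subspace_span[of F]]
  show "symmetric ?P" "orthonormal_basis E" by fact+
  show "?P *v e = of_bool (e \<in> F) *\<^sub>R e" if e: "e \<in> E" for e
  proof (cases "e \<in> F")
    case True
    hence "e \<in> Ran ?P" using P(3) by (simp add: span_base)
    then obtain y where "e = ?P *v y" by (auto simp: Ran_def)
    thus ?thesis using True P(2) by (simp add: matrix_vector_mul_assoc)
  next
    case False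
    have "?P *v (?P *v e) \<in> span F" using P(3) by (auto simp: Ran_def)
    hence "orthogonal e (?P *v (?P *v e))"
      by (rule orthogonal_to_span)
        (use F False e orthonormal_basis_inner[OF E] in \<open>auto simp: orthogonal_def subset_iff\<close>)
    hence "(?P *v e) \<bullet> (?P *v e) = 0"
      using symmetric_inner[OF P(1), of e "?P *v e"] by (simp add: orthogonal_def)
    thus ?thesis using False by simp
  qed
qed

context eigenbasis
begin

lemma norm_basis: "e \<in> E \<Longrightarrow> norm e = 1"
  using basis by (simp add: orthonormal_basis_def)

lemma inner_eigen: "e \<in> E \<Longrightarrow> (C *v x) \<bullet> e = \<gamma> e * (x \<bullet> e)"
  using symmetric_inner[OF sym] eigen by simp

text \<open>Both products scale each vector of the shared basis by the product of the two
  eigenvalues.\<close>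

lemma commutator_eq_0:
  assumes "eigenbasis D E \<delta>"
  shows "commutator C D = 0"
proof -
  interpret D: eigenbasis D E \<delta> by fact
  have "C ** D = D ** C"
    using basis by (rule orthonormal_basis_matrix_eqI)
      (simp add: matrix_vector_mul_assoc[symmetric] eigen D.eigen matrix_vector_mult_scaleR)
  thus ?thesis by (simp add: commutator_def)
qed

section \<open>Eigenspaces, ordered eigenvalues and spectral projectors\<close>

text \<open>Pairing \<open>C *v x = \<mu> *\<^sub>R x\<close> with \<open>e\<close> gives
  \<open>\<gamma> e * (x \<bullet> e) = \<mu> * (x \<bullet> e)\<close>, so \<open>x\<close> has no
  component along basis vectors with another eigenvalue.\<close>

lemma eigenspace_eq_span: "eigenspace C \<mu> = span {e\<in>E. \<gamma> e = \<mu>}"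
proof
  have "subspace (eigenspace C \<mu>)"
    by (simp add: eigenspace_def Ker_def subspace_def matrix_vector_right_distrib matrix_vector_mult_scaleR)
  moreover have "{e\<in>E. \<gamma> e = \<mu>} \<subseteq> eigenspace C \<mu>"
    by (auto simp: eigenspace_def Ker_def matrix_vector_mult_diff_rdistrib mat_vector_mult eigen)
  ultimately show "span {e\<in>E. \<gamma> e = \<mu>} \<subseteq> eigenspace C \<mu>" by (intro span_minimal)
  show "eigenspace C \<mu> \<subseteq> span {e\<in>E. \<gamma> e = \<mu>}"
  proof
    fix x assume "x \<in> eigenspace C \<mu>"
    hence "C *v x = \<mu> *\<^sub>R x"
      by (simp add: eigenspace_def Ker_def matrix_vector_mult_diff_rdistrib mat_vector_mult)
    hence "x \<bullet> e = 0" if "e \<in> E" "\<gamma> e \<noteq> \<mu>" for e using inner_eigen[OF that(1), of x] that by simp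
    hence "(x \<bullet> e) *\<^sub>R e \<in> span {e\<in>E. \<gamma> e = \<mu>}" if "e \<in> E" for e
      using that by (cases "\<gamma> e = \<mu>") (auto intro: span_scale span_base span_zero)
    hence "(\<Sum>e\<in>E. (x \<bullet> e) *\<^sub>R e) \<in> span {e\<in>E. \<gamma> e = \<mu>}" by (rule span_sum)
    thus "x \<in> span {e\<in>E. \<gamma> e = \<mu>}" by (simp add: orthonormal_basis_sum[OF basis])
  qed
qed

lemma dim_eigenspace: "dim (eigenspace C \<mu>) = card {e\<in>E. \<gamma> e = \<mu>}"
proof -
  have "independent {e\<in>E. \<gamma> e = \<mu>}"
    using orthonormal_basis_independent[OF basis] by (rule independent_mono) auto
  thus ?thesis unfolding eigenspace_eq_span by (rule dim_span_eq_card_independent)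
qed

lemma eigenvalues_eq: "eigenvalues C = image_mset \<gamma> (mset_set E)"
proof (rule multiset_eqI)
  fix x
  note fin = orthonormal_basis_finite[OF basis]
  \<comment> \<open>Identifies the index set of the sum in \<open>eigenvalues\<close> with the image
    of \<open>E\<close> under \<open>\<gamma>\<close>, which is visibly finite.\<close>
  have "eigenspace C \<mu> = {0} \<longleftrightarrow> {e\<in>E. \<gamma> e = \<mu>} = {}" for \<mu>
  proof -
    have "0 \<in> eigenspace C \<mu>" by (simp add: eigenspace_eq_span span_zero)
    hence "eigenspace C \<mu> = {0} \<longleftrightarrow> dim (eigenspace C \<mu>) = 0" by auto
    thus ?thesis using fin by (simp add: dim_eigenspace)
  qed
  hence ev: "{\<mu>. eigenspace C \<mu> \<noteq> {0}} = \<gamma> ` E" by auto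
  have "count (eigenvalues C) x = (\<Sum>\<mu>\<in>\<gamma> ` E. if x = \<mu> then dim (eigenspace C \<mu>) else 0)"
    by (simp add: eigenvalues_def ev count_sum)
  also have "\<dots> = card {e\<in>E. \<gamma> e = x}"
    using fin by (auto simp: dim_eigenspace)
  also have "\<dots> = count (image_mset \<gamma> (mset_set E)) x"
    using fin by (simp add: count_image_mset Int_def conj_commute)
  finally show "count (eigenvalues C) x = count (image_mset \<gamma> (mset_set E)) x" .
qed

text \<open>These two counts are all that the minimization needs to know about the ordering of the
  eigenvalues.\<close>

lemma card_kth_eigenvalue:
  assumes "1 \<le> k" "k \<le> CARD('n)"
  shows "card {e\<in>E. \<gamma> e < kth_eigenvalue C k} < k"
    and "k \<le> card {e\<in>E. \<gamma> e \<le> kth_eigenvalue C k}"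
proof -
  define s where "s = sorted_list_of_multiset (eigenvalues C)"
  note fin = orthonormal_basis_finite[OF basis]
  have ms: "mset s = image_mset \<gamma> (mset_set E)" by (simp add: s_def eigenvalues_eq)
  have srt: "sorted s" by (simp add: s_def)
  have len: "length s = CARD('n)"
    using arg_cong[OF ms, of size] by (simp add: orthonormal_basis_card[OF basis])
  \<comment> \<open>Counting basis vectors by their eigenvalue becomes counting positions in the
    sorted list.\<close>
  have cnt: "card {e\<in>E. Q (\<gamma> e)} = card {i. i < length s \<and> Q (s ! i)}" for Q
  proof -
    have "card {i. i < length s \<and> Q (s ! i)} = size (filter_mset Q (mset s))"
      by (simp add: length_filter_conv_card[symmetric] mset_filter[symmetric] del: mset_filter)
    also have "\<dots> = card {e\<in>E. Q (\<gamma> e)}"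
      using fin by (simp add: ms filter_mset_image_mset filter_mset_mset_set)
    finally show ?thesis by simp
  qed
  have c: "kth_eigenvalue C k = s ! (k - 1)" by (simp add: kth_eigenvalue_def s_def)
  \<comment> \<open>A strictly smaller entry of a sorted list lies strictly to the left. Positions
    start at 0, so at most \<open>k - 1\<close> of them remain, which is below \<open>k\<close>
    because \<open>1 \<le> k\<close>.\<close>
  have "i < k - 1" if "i < length s" "s ! i < s ! (k - 1)" for i
    using that srt sorted_nth_mono[of s "k - 1" i] by (meson leD leI)
  hence "{i. i < length s \<and> s ! i < s ! (k - 1)} \<subseteq> {..<k - 1}" by auto
  from card_mono[OF _ this] show "card {e\<in>E. \<gamma> e < kth_eigenvalue C k} < k"
    unfolding c cnt[of "\<lambda>x. x < s ! (k - 1)"] using assms by simp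
  have "{..<k} \<subseteq> {i. i < length s \<and> s ! i \<le> s ! (k - 1)}"
    using srt assms len by (auto intro!: sorted_nth_mono)
  from card_mono[OF _ this] show "k \<le> card {e\<in>E. \<gamma> e \<le> kth_eigenvalue C k}"
    unfolding c cnt[of "\<lambda>x. x \<le> s ! (k - 1)"] by simp
qed

lemma spectral_projector_eigenbasis:
  "eigenbasis (spectral_projector I C) E (\<lambda>e. of_bool (\<gamma> e \<in> I))"
proof -
  have "span (\<Union>\<mu>\<in>I. eigenspace C \<mu>) = span {e\<in>E. \<gamma> e \<in> I}"
  proof (rule subset_antisym; rule span_minimal)
    show "(\<Union>\<mu>\<in>I. eigenspace C \<mu>) \<subseteq> span {e\<in>E. \<gamma> e \<in> I}"
      unfolding eigenspace_eq_span by (intro UN_least span_mono) auto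
    show "{e\<in>E. \<gamma> e \<in> I} \<subseteq> span (\<Union>\<mu>\<in>I. eigenspace C \<mu>)"
      unfolding eigenspace_eq_span by (auto intro!: span_base)
  qed auto
  hence "spectral_projector I C = orth_projector (span {e\<in>E. \<gamma> e \<in> I})"
    by (simp add: spectral_projector_def)
  moreover have "eigenbasis (orth_projector (span {e\<in>E. \<gamma> e \<in> I})) E (\<lambda>e. of_bool (e \<in> {e\<in>E. \<gamma> e \<in> I}))"
    using basis by (rule orth_projector_span_eigenbasis) auto
  ultimately show ?thesis by (simp add: eigenbasis_def)
qed

section \<open>The linear functional \<open>trace (C ** P)\<close> on the Grassmannian\<close>

lemma trace_eq: "trace C = sum \<gamma> E"
proof -
  have "trace C = (\<Sum>e\<in>E. e \<bullet> (C *v e))" by (rule trace_orthonormal_basis[OF basis])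
  also have "\<dots> = sum \<gamma> E"
    using norm_basis by (intro sum.cong) (auto simp: eigen norm_eq_1)
  finally show ?thesis .
qed

lemma trace_mult: "trace (C ** P) = (\<Sum>e\<in>E. \<gamma> e * (e \<bullet> (P *v e)))"
  unfolding trace_orthonormal_basis[OF basis]
  by (intro sum.cong refl)
    (simp add: matrix_vector_mul_assoc[symmetric] symmetric_inner[OF sym, symmetric] eigen)

text \<open>Since the weights \<open>e \<bullet> (P *v e)\<close> add up to \<open>m\<close>,
  subtracting \<open>\<mu> * m\<close> replaces \<open>\<gamma> e\<close> by
  \<open>\<gamma> e - \<mu>\<close>. A weight in [0,1] times this number is at least
  \<open>min (\<gamma> e - \<mu>) 0\<close>, with equality exactly for weight 1 below the level, 0
  above it, and any weight at it. The level \<open>\<mu>\<close> is arbitrary here.\<close>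

lemma
  assumes P: "P \<in> Gr m"
  shows trace_mult_ge: "\<mu> * m + (\<Sum>e\<in>E. min (\<gamma> e - \<mu>) 0) \<le> trace (C ** P)"
    and trace_mult_eq_iff: "trace (C ** P) = \<mu> * m + (\<Sum>e\<in>E. min (\<gamma> e - \<mu>) 0) \<longleftrightarrow>
      (\<forall>e\<in>E. (\<gamma> e < \<mu> \<longrightarrow> P *v e = e) \<and> (\<gamma> e > \<mu> \<longrightarrow> P *v e = 0))"
proof -
  have sP: "symmetric P" "P ** P = P" and t: "trace P = m" using P by (auto simp: Gr_def)
  define f where "f e = (\<gamma> e - \<mu>) * (e \<bullet> (P *v e)) - min (\<gamma> e - \<mu>) 0" for e
  have eq: "trace (C ** P) - (\<mu> * m + (\<Sum>e\<in>E. min (\<gamma> e - \<mu>) 0)) = sum f E"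
    using t trace_orthonormal_basis[OF basis, of P]
    by (simp add: f_def trace_mult sum_subtractf sum_distrib_left[symmetric] left_diff_distrib mult.assoc)
  have f: "0 \<le> f e \<and> (f e = 0 \<longleftrightarrow> (\<gamma> e < \<mu> \<longrightarrow> P *v e = e) \<and> (\<gamma> e > \<mu> \<longrightarrow> P *v e = 0))" if "e \<in> E" for e
  proof -
    note p = projector_quadratic_nonneg[OF sP norm_basis[OF that]]
      projector_quadratic_le_1[OF sP norm_basis[OF that]]
      projector_quadratic_eq_0[OF sP norm_basis[OF that]]
      projector_quadratic_eq_1[OF sP norm_basis[OF that]]
    consider "\<gamma> e < \<mu>" | "\<gamma> e = \<mu>" | "\<gamma> e > \<mu>" by linarith
    thus ?thesis
    proof cases
      case 1
      hence "f e = (\<mu> - \<gamma> e) * (1 - e \<bullet> (P *v e))" by (simp add: f_def algebra_simps)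
      thus ?thesis using 1 p by auto
    next
      case 3
      hence "f e = (\<gamma> e - \<mu>) * (e \<bullet> (P *v e))" by (simp add: f_def)
      thus ?thesis using 3 p by auto
    qed (simp add: f_def)
  qed
  have "0 \<le> sum f E" using f by (simp add: sum_nonneg)
  thus "\<mu> * m + (\<Sum>e\<in>E. min (\<gamma> e - \<mu>) 0) \<le> trace (C ** P)" using eq by simp
  have "sum f E = 0 \<longleftrightarrow> (\<forall>e\<in>E. f e = 0)"
    using f orthonormal_basis_finite[OF basis] by (simp add: sum_nonneg_eq_0_iff)
  thus "trace (C ** P) = \<mu> * m + (\<Sum>e\<in>E. min (\<gamma> e - \<mu>) 0) \<longleftrightarrow>
      (\<forall>e\<in>E. (\<gamma> e < \<mu> \<longrightarrow> P *v e = e) \<and> (\<gamma> e > \<mu> \<longrightarrow> P *v e = 0))" using f eq by auto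
qed

text \<open>Translates the equality condition into the form with \<open>\<Delta>\<close>. If
  \<open>P\<close> fixes the basis vectors below the level, it absorbs \<open>Q \<mu>\<close> on
  both sides, so the difference is again a projector; conversely a projector living on the
  eigenspace at the level is orthogonal to \<open>Q \<mu>\<close>, so their sum is a
  projector.\<close>

lemma projector_decomposition:
  defines "Q \<equiv> \<lambda>\<mu>. spectral_projector {..<\<mu>} C"
  shows "symmetric P \<and> P ** P = P \<and> (\<forall>e\<in>E. (\<gamma> e < \<mu> \<longrightarrow> P *v e = e) \<and> (\<gamma> e > \<mu> \<longrightarrow> P *v e = 0)) \<longleftrightarrow>
    (P - Q \<mu>) ** (P - Q \<mu>) = P - Q \<mu> \<and> P - Q \<mu> = transpose (P - Q \<mu>) \<and> Ran (P - Q \<mu>) \<subseteq> Ker (C - mat \<mu>)"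
    (is "?L \<longleftrightarrow> ?R")
proof -
  define D where "D = P - Q \<mu>"
  interpret Q: eigenbasis "Q \<mu>" E "\<lambda>e. of_bool (\<gamma> e \<in> {..<\<mu>})"
    unfolding Q_def by (rule spectral_projector_eigenbasis)
  have Qe: "Q \<mu> *v e = (if \<gamma> e < \<mu> then e else 0)" if "e \<in> E" for e using Q.eigen[OF that] by simp
  have QQ: "Q \<mu> ** Q \<mu> = Q \<mu>"
    using basis by (rule orthonormal_basis_matrix_eqI) (simp add: matrix_vector_mul_assoc[symmetric] Qe)
  have symC: "symmetric (C - mat \<mu>)" using sym by (simp add: symmetric_def transpose_diff)
  have De: "D ** (C - mat \<mu>) = 0 \<longleftrightarrow> (\<forall>e\<in>E. \<gamma> e \<noteq> \<mu> \<longrightarrow> D *v e = 0)"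
  proof -
    have e: "(D ** (C - mat \<mu>)) *v e = (\<gamma> e - \<mu>) *\<^sub>R (D *v e)" if "e \<in> E" for e
    proof -
      have "(C - mat \<mu>) *v e = (\<gamma> e - \<mu>) *\<^sub>R e"
        using eigen[OF that] by (simp add: matrix_vector_mult_diff_rdistrib mat_vector_mult scaleR_diff_left)
      thus ?thesis by (simp add: matrix_vector_mul_assoc[symmetric] matrix_vector_mult_scaleR)
    qed
    have "D ** (C - mat \<mu>) = 0 \<longleftrightarrow> (\<forall>e\<in>E. (D ** (C - mat \<mu>)) *v e = 0)"
      using orthonormal_basis_matrix_eqI[OF basis, of "D ** (C - mat \<mu>)" 0] by auto
    thus ?thesis by (auto simp: e)
  qed
  \<comment> \<open>The range condition puts \<open>C - mat \<mu>\<close> on the left of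
    \<open>D\<close>, the test on basis vectors puts it on the right; transposition exchanges the
    two.\<close>
  have tr: "(C - mat \<mu>) ** D = 0 \<longleftrightarrow> D ** (C - mat \<mu>) = 0" if "symmetric D"
    using symmetric_transpose_mult[OF symC that] symmetric_transpose_mult[OF that symC]
    by (metis transpose_transpose transpose_mat mat_0)
  have symD: "D = transpose D \<longleftrightarrow> symmetric D" by (auto simp: symmetric_def)
  have P: "P = Q \<mu> + D" by (simp add: D_def)
  have "?L \<longleftrightarrow> D ** D = D \<and> symmetric D \<and> D ** (C - mat \<mu>) = 0"
  proof (safe)
    assume L: "symmetric P" "P ** P = P"
      and Pe: "\<forall>e\<in>E. (\<gamma> e < \<mu> \<longrightarrow> P *v e = e) \<and> (\<gamma> e > \<mu> \<longrightarrow> P *v e = 0)"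
    show "symmetric D" using L Q.sym by (simp add: D_def symmetric_def transpose_diff)
    have PQ: "P ** Q \<mu> = Q \<mu>" using basis
      by (rule orthonormal_basis_matrix_eqI) (use Pe in \<open>simp add: matrix_vector_mul_assoc[symmetric] Qe\<close>)
    hence "Q \<mu> ** P = Q \<mu>" using symmetric_transpose_mult[OF L(1) Q.sym] Q.sym by (simp add: symmetric_def)
    thus "D ** D = D" by (simp add: D_def matrix_diff_ldistrib matrix_diff_rdistrib L PQ QQ)
    show "D ** (C - mat \<mu>) = 0"
      unfolding De using Pe by (auto simp: D_def matrix_vector_mult_diff_rdistrib Qe)
  next
    assume D: "D ** D = D" "symmetric D" "D ** (C - mat \<mu>) = 0"
    show "symmetric P" using D Q.sym by (simp add: P symmetric_def transpose_add)
    have D0: "D *v e = 0" if "e \<in> E" "\<gamma> e \<noteq> \<mu>" for e using De D(3) that by blast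
    have DQ: "D ** Q \<mu> = 0" using basis
      by (rule orthonormal_basis_matrix_eqI) (use D0 in \<open>simp add: matrix_vector_mul_assoc[symmetric] Qe\<close>)
    hence QD: "Q \<mu> ** D = 0"
      using symmetric_transpose_mult[OF D(2) Q.sym] by (metis transpose_mat mat_0)
    show "P ** P = P"
      by (simp add: P matrix_add_ldistrib matrix_add_rdistrib D DQ QD QQ)
    show "P *v e = e" if "e \<in> E" "\<gamma> e < \<mu>" for e
      using that D0 by (simp add: P matrix_vector_mult_add_rdistrib Qe)
    show "P *v e = 0" if "e \<in> E" "\<gamma> e > \<mu>" for e
      using that D0 by (simp add: P matrix_vector_mult_add_rdistrib Qe)
  qed
  also have "\<dots> \<longleftrightarrow> D ** D = D \<and> D = transpose D \<and> Ran D \<subseteq> Ker (C - mat \<mu>)"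
    unfolding symD Ran_subset_Ker_iff using tr by blast
  finally show ?thesis by (simp add: D_def)
qed

end

section \<open>Attainment of the lower bound and the set of minimizers\<close>

lemma of_bool_eigenbasis_in_Gr:
  assumes "eigenbasis P E (\<lambda>e. of_bool (e \<in> F))" and F: "F \<subseteq> E" "card F = m"
  shows "P \<in> Gr m"
proof -
  interpret P: eigenbasis P E "\<lambda>e. of_bool (e \<in> F)" by fact
  have "P ** P = P" using P.basis
    by (rule orthonormal_basis_matrix_eqI)
      (simp add: matrix_vector_mul_assoc[symmetric] P.eigen matrix_vector_mult_scaleR)
  moreover have "trace P = card (E \<inter> F)"
    using orthonormal_basis_finite[OF P.basis] by (simp add: P.trace_eq Int_def)
  ultimately show ?thesis using P.sym F by (simp add: Gr_def Int_absorb1)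
qed

lemma minimizers_eqI:
  fixes f :: "'a \<Rightarrow> real"
  assumes "\<And>x. x \<in> S \<Longrightarrow> v \<le> f x" and "x0 \<in> S" "f x0 = v"
  shows "minimizers f S = {x\<in>S. f x = v}"
  unfolding minimizers_def is_arg_min_def using assms by (auto simp: not_less intro: antisym)

theorem proposition6:
  fixes A B C :: "real^'n^'n" and m :: nat and c :: "nat \<Rightarrow> real"
  assumes "1 \<le> m" and "m \<le> CARD('n) - 1"
    and "symmetric A" and "symmetric B"
    and "psd A" and "commutator A B = 0"
    and C: "C = B - (1/2) *\<^sub>R (A ** A)"
    and c: "c = kth_eigenvalue C"
  shows "minimizers (J A B) (Gr m) =
           {P. \<exists>\<Delta>. P = spectral_projector {..<c m} C + \<Delta> \<and>
                  \<Delta> ** \<Delta> = \<Delta> \<and> \<Delta> = transpose \<Delta> \<and>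
                  Ran \<Delta> \<subseteq> Ker (C - mat (c m)) \<and>
                  trace P = real m \<and> commutator A \<Delta> = 0} \<and>
         (c m < c (m + 1) \<longrightarrow>
           minimizers (J A B) (Gr m) = {spectral_projector {..c m} C} \<and>
           pairwise (\<lambda>X Y. commutator X Y = 0) {A, B, C, spectral_projector {..c m} C})"
proof -
  have mn: "m \<le> CARD('n)" "m + 1 \<le> CARD('n)" using assms(1,2) by linarith+
  have AB: "A ** B = B ** A" using assms(6) by (simp add: commutator_def)
  have symC: "symmetric C" using assms(3,4)
    by (simp add: C symmetric_def transpose_diff transpose_scalar matrix_transpose_mul)
  have AC: "A ** C = C ** A"
    by (simp add: C matrix_diff_ldistrib matrix_diff_rdistrib AB matrix_scalar_ac
        scalar_matrix_assoc[symmetric] matrix_mul_assoc)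
  obtain E \<alpha> \<gamma> where E: "orthonormal_basis E"
    "\<And>e. e \<in> E \<Longrightarrow> A *v e = \<alpha> e *\<^sub>R e" "\<And>e. e \<in> E \<Longrightarrow> C *v e = \<gamma> e *\<^sub>R e"
    using commuting_eigenbasis[OF assms(3) symC AC] by metis
  interpret A: eigenbasis A E \<alpha> using assms(3) E by unfold_locales
  interpret C: eigenbasis C E \<gamma> using symC E by unfold_locales
  note fin = orthonormal_basis_finite[OF E(1)]
  define \<mu> where "\<mu> = c m"
  \<comment> \<open>The bound of \<open>trace_mult_ge\<close> at the level \<open>c m\<close>, which
    turns out to be the minimum of \<open>J\<close>.\<close>
  define v where "v = \<mu> * m + (\<Sum>e\<in>E. min (\<gamma> e - \<mu>) 0)"
  define opt where
    "opt P \<longleftrightarrow> (\<forall>e\<in>E. (\<gamma> e < \<mu> \<longrightarrow> P *v e = e) \<and> (\<gamma> e > \<mu> \<longrightarrow> P *v e = 0))" for P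
  have J: "v \<le> J A B P" "J A B P = v \<longleftrightarrow> opt P \<and> commutator A P = 0" if P: "P \<in> Gr m" for P
  proof -
    have "symmetric P" "P ** P = P" using P by (auto simp: Gr_def)
    from J_commutator[OF assms(3) this, of B]
    have eq: "J A B P = trace (C ** P) + (1/4) * trace (transpose (commutator A P) ** commutator A P)"
      by (simp add: C)
    note t = C.trace_mult_ge[OF P, of \<mu>] C.trace_mult_eq_iff[OF P, of \<mu>]
      trace_transpose_mult_self[of "commutator A P"]
    show "v \<le> J A B P" using t(1,3) unfolding eq v_def by simp
    \<comment> \<open>\<open>J\<close> is a term that is at least \<open>v\<close> plus a
      nonnegative one, so it equals \<open>v\<close> only if both are extremal.\<close>
    have "J A B P = v \<longleftrightarrow> trace (C ** P) = v \<and> trace (transpose (commutator A P) ** commutator A P) = 0"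
      using t(1,3) unfolding eq v_def[symmetric] by auto
    thus "J A B P = v \<longleftrightarrow> opt P \<and> commutator A P = 0"
      using t(2,4) by (simp add: v_def opt_def)
  qed
  have lo: "card {e\<in>E. \<gamma> e < \<mu>} < m" and hi: "m \<le> card {e\<in>E. \<gamma> e \<le> \<mu>}"
    using C.card_kth_eigenvalue[OF assms(1) mn(1)] by (simp_all add: \<mu>_def c)
  \<comment> \<open>A 0-1 diagonal matrix in \<open>E\<close> commutes with \<open>A\<close>, so
    both parts of the bound are attained at once.\<close>
  have attained: "P \<in> Gr m \<and> J A B P = v"
    if P: "eigenbasis P E (\<lambda>e. of_bool (e \<in> F))" and F: "{e\<in>E. \<gamma> e < \<mu>} \<subseteq> F" "F \<subseteq> {e\<in>E. \<gamma> e \<le> \<mu>}" "card F = m"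
    for P F
  proof -
    have "P \<in> Gr m" using F by (intro of_bool_eigenbasis_in_Gr[OF P]) auto
    moreover have "opt P"
      unfolding opt_def using eigenbasis.eigen[OF P] F by (auto simp: subset_iff)
    ultimately show ?thesis using J A.commutator_eq_0[OF P] by simp
  qed
  \<comment> \<open>By \<open>lo\<close> and \<open>hi\<close> the basis vectors below the level can
    be filled up to exactly \<open>m\<close> with vectors at the level.\<close>
  obtain F where F: "{e\<in>E. \<gamma> e < \<mu>} \<subseteq> F" "F \<subseteq> {e\<in>E. \<gamma> e \<le> \<mu>}" "card F = m"
  proof -
    have "{e\<in>E. \<gamma> e < \<mu>} \<subseteq> {e\<in>E. \<gamma> e \<le> \<mu>}" by auto
    from exists_subset_between[OF less_imp_le[OF lo] hi this] show thesis using fin that by auto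
  qed
  have "eigenbasis (orth_projector (span F)) E (\<lambda>e. of_bool (e \<in> F))"
    using E(1) F by (intro orth_projector_span_eigenbasis) auto
  from attained[OF this F] have "minimizers (J A B) (Gr m) = {P\<in>Gr m. J A B P = v}"
    using J(1) by (intro minimizers_eqI) auto
  also have "\<dots> = {P\<in>Gr m. opt P \<and> commutator A P = 0}" using J(2) by blast
  finally have min: "minimizers (J A B) (Gr m) = {P\<in>Gr m. opt P \<and> commutator A P = 0}" .
  let ?Q = "spectral_projector {..<\<mu>} C"
  \<comment> \<open>\<open>?Q\<close> is diagonal in \<open>E\<close> and so commutes with
    \<open>A\<close>; the commutator condition is the same for \<open>P\<close> and for
    \<open>\<Delta>\<close>.\<close>
  have comm: "commutator A (P - ?Q) = commutator A P" for P
  proof -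
    have "commutator A ?Q = 0" by (rule A.commutator_eq_0[OF C.spectral_projector_eigenbasis])
    thus ?thesis by (simp add: commutator_def matrix_diff_ldistrib matrix_diff_rdistrib)
  qed
  have "P \<in> minimizers (J A B) (Gr m) \<longleftrightarrow>
      (symmetric P \<and> P ** P = P \<and> opt P) \<and> trace P = real m \<and> commutator A P = 0" for P
    unfolding min by (auto simp: Gr_def)
  hence "P \<in> minimizers (J A B) (Gr m) \<longleftrightarrow> (P - ?Q) ** (P - ?Q) = P - ?Q \<and> P - ?Q = transpose (P - ?Q) \<and>
      Ran (P - ?Q) \<subseteq> Ker (C - mat \<mu>) \<and> trace P = real m \<and> commutator A (P - ?Q) = 0" for P
    unfolding opt_def C.projector_decomposition comm by blast
  moreover have "(\<exists>\<Delta>. P = ?Q + \<Delta> \<and> R \<Delta>) \<longleftrightarrow> R (P - ?Q)" for P R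
    by (metis add_diff_cancel_left' diff_add_cancel add.commute)
  ultimately have part1: "minimizers (J A B) (Gr m) = {P. \<exists>\<Delta>. P = ?Q + \<Delta> \<and>
                  \<Delta> ** \<Delta> = \<Delta> \<and> \<Delta> = transpose \<Delta> \<and>
                  Ran \<Delta> \<subseteq> Ker (C - mat \<mu>) \<and>
                  trace P = real m \<and> commutator A \<Delta> = 0}"
    by (intro set_eqI) simp
  let ?R = "spectral_projector {..\<mu>} C"
  have R: "eigenbasis ?R E (\<lambda>e. of_bool (\<gamma> e \<in> {..\<mu>}))"
    by (rule C.spectral_projector_eigenbasis)
  have part2: "minimizers (J A B) (Gr m) = {?R}" if gap: "c m < c (m + 1)"
  proof -
    \<comment> \<open>Across the gap, eigenvalues up to \<open>c m\<close> lie strictly below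
      \<open>c (m + 1)\<close>, and fewer than \<open>m + 1\<close> do so; with \<open>hi\<close>
      there are exactly \<open>m\<close>.\<close>
    have "card {e\<in>E. \<gamma> e \<le> \<mu>} \<le> card {e\<in>E. \<gamma> e < c (m + 1)}"
      using gap fin by (intro card_mono) (auto simp: \<mu>_def)
    also have "\<dots> < m + 1" using C.card_kth_eigenvalue(1)[OF _ mn(2)] by (simp add: c)
    finally have card: "card {e\<in>E. \<gamma> e \<le> \<mu>} = m" using hi by simp
    have "eigenbasis ?R E (\<lambda>e. of_bool (e \<in> {e\<in>E. \<gamma> e \<le> \<mu>}))"
      using R by (simp add: eigenbasis_def)
    from attained[OF this _ order_refl card] have "?R \<in> Gr m \<and> J A B ?R = v" by force
    hence Rmin: "?R \<in> minimizers (J A B) (Gr m)" using J(2)[of ?R] by (simp add: min)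
    have "P = ?R" if "P \<in> minimizers (J A B) (Gr m)" for P
    proof -
      have P: "symmetric P" "P ** P = P" "trace P = m" and sp: "opt P"
        using that unfolding min by (auto simp: Gr_def)
      \<comment> \<open>Weights above the level vanish, so the \<open>m\<close> remaining ones, each
        at most 1, add up to \<open>m\<close>. Hence each is 1 and \<open>P\<close> is determined on
        all of \<open>E\<close>.\<close>
      have "(\<Sum>e\<in>{e\<in>E. \<gamma> e \<le> \<mu>}. e \<bullet> (P *v e)) = (\<Sum>e\<in>E. e \<bullet> (P *v e))"
        using fin sp by (intro sum.mono_neutral_left) (auto simp: opt_def)
      also have "\<dots> = (\<Sum>e\<in>{e\<in>E. \<gamma> e \<le> \<mu>}. 1)"
        using P card by (simp add: trace_orthonormal_basis[OF E(1), symmetric])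
      finally have "(\<Sum>e\<in>{e\<in>E. \<gamma> e \<le> \<mu>}. 1 - e \<bullet> (P *v e)) = 0" by (simp add: sum_subtractf)
      moreover have "0 \<le> 1 - e \<bullet> (P *v e)" if "e \<in> E" for e
        using projector_quadratic_le_1[OF P(1,2) C.norm_basis[OF that]] by simp
      ultimately have "\<forall>e\<in>{e\<in>E. \<gamma> e \<le> \<mu>}. 1 - e \<bullet> (P *v e) = 0"
        using fin by (subst (asm) sum_nonneg_eq_0_iff) auto
      hence "P *v e = e" if "e \<in> E" "\<gamma> e \<le> \<mu>" for e
        using projector_quadratic_eq_1[OF P(1,2) C.norm_basis[OF that(1)]] that by auto
      hence "P *v e = ?R *v e" if "e \<in> E" for e
        using that sp eigenbasis.eigen[OF R that] by (cases "\<gamma> e \<le> \<mu>") (auto simp: opt_def)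
      thus ?thesis by (rule orthonormal_basis_matrix_eqI[OF E(1)])
    qed
    thus ?thesis using Rmin by blast
  qed
  \<comment> \<open>Solving the definition of \<open>C\<close> for \<open>B\<close> shows that
    \<open>B\<close> is diagonal in the same basis, which gives all pairwise commutations.\<close>
  have B: "eigenbasis B E (\<lambda>e. \<gamma> e + (1/2) * (\<alpha> e * \<alpha> e))"
  proof
    show "B *v e = (\<gamma> e + (1/2) * (\<alpha> e * \<alpha> e)) *\<^sub>R e" if "e \<in> E" for e
    proof -
      have "B = C + (1/2) *\<^sub>R (A ** A)" by (simp add: C)
      thus ?thesis using that
        by (simp add: matrix_vector_mult_add_rdistrib scaleR_matrix_vector_assoc[symmetric]
            matrix_vector_mul_assoc[symmetric] A.eigen C.eigen matrix_vector_mult_scaleR scaleR_add_left)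
    qed
  qed (fact assms E)+
  have "\<exists>\<delta>. eigenbasis X E \<delta>" if "X \<in> {A, B, C, ?R}" for X
    using that A.eigenbasis_axioms B C.eigenbasis_axioms R by blast
  hence "pairwise (\<lambda>X Y. commutator X Y = 0) {A, B, C, ?R}"
    unfolding pairwise_def by (meson eigenbasis.commutator_eq_0)
  thus ?thesis using part1 part2 unfolding \<mu>_def by blast
qed

end
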